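(* Let $X$ be a normed space, let $\mathcal{C}\subset X$ be a co-radiant subset with $d_{\mathcal{C}}>0$, and let $A\subset X$. Assume that there exist $\delta\in\mathbb{R}$ with $0<\delta<d_{\mathcal{C}}$, and $n\in\mathbb{N}$ such that $\mathcal{C}\cap nS_X\neq\emptyset$, and the pair $(\mathrm{cone}(\mathcal{C}),\mathrm{cone}(\mathcal{C}_{\delta}\cap nS_X))$ satisfies the SSP, where $\mathcal{C}_\delta$ is the $\delta$-co-radiant neighborhood of $\mathcal{C}$. Then there exist $\alpha_1,\alpha_2\in\mathbb{R}$ with $0<\alpha_1<\alpha_2\leq1$, $f\in S_{X^*}$, and $0<\eta\leq1$ such that: (i) $\lambda:=\inf\{f(x')-\alpha\|x'\|: x'\in\mathcal{C},\ \alpha\in(\alpha_1,\alpha_2)\}>0$. (ii) If $0<\varepsilon<1$, $\alpha\in(\alpha_1,\alpha_2)$, and $x_0\in AE(A,\mathcal{C}_{\delta}(\eta),\varepsilon)$, then $$p_{f,\alpha}(x-x_0)>-\lambda\varepsilon\quad\forall x\in A,$$ and $$\left[x_0+\{x\in X: p_{f,\alpha}(x)<0\}\right]\cap A\ \subset\ AE(A,\mathcal{C},\varepsilon).$$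
   Context: $X$ is a real normed space with zero $0_X$, dual $X^*$ with dual norm $\|\cdot\|_*$, closed unit ball $B_X$, unit sphere $S_X=\{x:\|x\|=1\}$, and $S_{X^*}=\{f\in X^*:\|f\|_*=1\}$. $\mathrm{bd}$, $\mathrm{co}$ and an overline denote boundary, convex hull and closure. Cone: a set $C\subset X$ with $\lambda x\in C$ for all $\lambda\ge 0$, $x\in C$. For $S\subset X$, $\mathrm{cone}(S)=\{\lambda s:\lambda\ge0,\ s\in S\}$. A co-radiant set is a set $\mathcal{C}\subset X$ with $\mathcal{C}\ne\emptyset$, $\mathcal{C}\neq X$ and $\lambda x\in\mathcal{C}$ for all $\lambda\ge1$, $x\in\mathcal{C}$. For $\varepsilon>0$, $\mathcal{C}(\varepsilon):=\varepsilon\,\mathcal{C}$, and $d_{\mathcal{C}}:=\inf\{\|c\|:c\in\mathcal{C}\}$. $\delta$-co-radiant neighborhood: for $0<\delta<d_{\mathcal{C}}$, $\mathcal{C}_{\delta}:=\text{co-rad}(\mathcal{C}+\delta B_X)$, where $\text{co-rad}(S):=\{\lambda s:\lambda\geq1,\ s\in S\}$ is the co-radiant set generated by $S$. Thus $\mathcal{C}_\delta(\eta)=\eta\,\mathcal{C}_\delta$. SSP (strict separation property): a pair of cones $(C,K)$ in $X$ satisfies the SSP if $0_X\notin\overline{\mathrm{co}(C\cap S_X)-\mathrm{co}\big((\mathrm{bd}(K)\cap S_X)\cup\{0_X\}\big)}$. $\varepsilon$-efficient points: for a co-radiant set $\mathcal{D}\subset X$, $A\subset X$ and $\varepsilon>0$,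 $AE(A,\mathcal{D},\varepsilon)$ is the set of $x_0\in A$ such that $(A-x_0)\cap(-\varepsilon\mathcal{D})\subset\{0_X\}$. For $f\in X^*$, $\alpha>0$: $p_{f,\alpha}(x):=f(x)+\alpha\|x\|$ for $x\in X$. *)

theory Defs
  imports "HOL-Analysis.Analysis"
begin

text \<open>
  The dual space is \<open>'a \<Rightarrow>\<^sub>L real\<close> with its operator norm. The cone generated by a set
  is the library's \<open>cone hull\<close>, i.e. the set of all \<open>c *\<^sub>R x\<close> with \<open>0 \<le> c\<close> and \<open>x \<in> S\<close>
  (lemma \<open>cone_hull_expl\<close>). Minkowski differences are written as comprehensions, because
  \<open>-\<close> on sets is the set-theoretic difference.
\<close>

definition coradiant :: "'a::real_normed_vector set \<Rightarrow> bool" where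
  "coradiant C \<longleftrightarrow> C \<noteq> {} \<and> C \<noteq> UNIV \<and> (\<forall>x\<in>C. \<forall>c\<ge>1. c *\<^sub>R x \<in> C)"

definition corad_dist :: "'a::real_normed_vector set \<Rightarrow> real" where
  "corad_dist C = (INF c\<in>C. norm c)"

definition scaled :: "real \<Rightarrow> 'a::real_normed_vector set \<Rightarrow> 'a set" where
  "scaled t S = (\<lambda>x. t *\<^sub>R x) ` S"

definition corad :: "'a::real_normed_vector set \<Rightarrow> 'a set" where
  "corad S = {c *\<^sub>R s | c s. 1 \<le> c \<and> s \<in> S}"

definition corad_nbhd :: "'a::real_normed_vector set \<Rightarrow> real \<Rightarrow> 'a set" where
  "corad_nbhd C \<delta> = corad {c + b | c b. c \<in> C \<and> b \<in> scaled \<delta> (cball 0 1)}"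

text \<open>The strict separation property, meant for pairs of cones.\<close>

definition SSP :: "'a::real_normed_vector set \<Rightarrow> 'a set \<Rightarrow> bool" where
  "SSP C K \<longleftrightarrow>
     0 \<notin> closure {x - y | x y. x \<in> convex hull (C \<inter> sphere 0 1)
                             \<and> y \<in> convex hull ((frontier K \<inter> sphere 0 1) \<union> {0})}"

definition AE_points :: "'a::real_normed_vector set \<Rightarrow> 'a set \<Rightarrow> real \<Rightarrow> 'a set" where
  "AE_points A D \<epsilon> = {x0 \<in> A. (\<lambda>x. x - x0) ` A \<inter> scaled (- \<epsilon>) D \<subseteq> {0}}"

definition pfun :: "('a::real_normed_vector \<Rightarrow>\<^sub>L real) \<Rightarrow> real \<Rightarrow> 'a \<Rightarrow> real" where
  "pfun f \<alpha> x = blinfun_apply f x + \<alpha> * norm x"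

end

theory Submission
  imports Defs
begin

text \<open>
  Strict separation gives \<open>f\<close> of norm one and \<open>s \<ge> 0\<close>, \<open>r > 0\<close> such that \<open>f \<le> s\<close> on the unit
  vectors of the boundary of \<open>K = cone (C\<^sub>\<delta> \<inter> n S)\<close> and \<open>f \<ge> s + r\<close> on those of \<open>cone C\<close>.
  For \<open>\<alpha>\<close> strictly between, the convex cone \<open>{z. f z > \<alpha> \<parallel>z\<parallel>}\<close> contains \<open>C\<close> and avoids the
  boundary of \<open>K\<close>; being connected and meeting \<open>K\<close>, it lies inside \<open>K\<close>. Hence its elements of
  norm at least \<open>n\<close> belong to \<open>C\<^sub>\<delta>\<close>. If \<open>p (x - x0) \<le> -\<lambda>\<epsilon>\<close>, then \<open>x0 - x\<close> lies in that cone
  and has norm at least \<open>\<lambda>\<epsilon>\<close>, so with \<open>\<eta> \<le> \<lambda>/n\<close> it lies in \<open>\<epsilon>\<eta> C\<^sub>\<delta>\<close>, which efficiency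
  forbids. The inclusion follows from subadditivity of \<open>p\<close>.

  The separating functional is a minimal sublinear functional below the one in
  \<open>sublinear_lowering\<close>; minimal sublinear functionals are linear.
\<close>

section \<open>Sublinear functionals and separation\<close>

text \<open>Homogeneity is demanded for positive factors only; the value 0 at the origin follows
  from the factor 2.\<close>

definition sublinear :: "('a::real_vector \<Rightarrow> real) \<Rightarrow> bool" where
  "sublinear p \<longleftrightarrow> (\<forall>x y. p (x + y) \<le> p x + p y) \<and> (\<forall>c>0. \<forall>x. p (c *\<^sub>R x) = c * p x)"

text \<open>One inequality suffices for homogeneity: applied to the factor \<open>1 / c\<close> and
  the vector \<open>c *\<^sub>R x\<close>, it gives the reverse one.\<close>

lemma sublinearI:
  assumes "\<And>x y. p (x + y) \<le> p x + p y" "\<And>c x. c > 0 \<Longrightarrow> p (c *\<^sub>R x) \<le> c * p x"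
  shows "sublinear p"
proof -
  have "p (c *\<^sub>R x) = c * p x" if "c > 0" for c x
  proof -
    have "p ((1 / c) *\<^sub>R (c *\<^sub>R x)) \<le> (1 / c) * p (c *\<^sub>R x)"
      using assms(2) that by (metis zero_less_divide_1_iff)
    then have "c * p x \<le> p (c *\<^sub>R x)"
      using that by (simp add: field_simps)
    then show ?thesis using assms(2)[OF that, of x] by simp
  qed
  then show ?thesis using assms(1) unfolding sublinear_def by blast
qed

lemma sublinear_add: "sublinear p \<Longrightarrow> p (x + y) \<le> p x + p y"
  and sublinear_scale: "sublinear p \<Longrightarrow> c > 0 \<Longrightarrow> p (c *\<^sub>R x) = c * p x"
  by (auto simp: sublinear_def)

lemma sublinear_zero:
  assumes "sublinear p" shows "p 0 = 0"
  using sublinear_scale[OF assms, of 2 0] by simp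

lemma sublinear_scale_nonneg:
  assumes "sublinear p" "c \<ge> 0" shows "p (c *\<^sub>R x) = c * p x"
  using assms sublinear_scale[of p c x] sublinear_zero[of p] by (cases "c = 0") auto

lemma sublinear_minus_le:
  assumes "sublinear p" shows "- p (- x) \<le> p x"
  using sublinear_add[OF assms, of x "- x"] sublinear_zero[OF assms] by simp

text \<open>Oddness turns subadditivity at \<open>- x\<close> and \<open>- y\<close> into
  superadditivity at \<open>x\<close> and \<open>y\<close>, and carries homogeneity over to negative
  factors.\<close>

lemma sublinear_odd_imp_linear:
  assumes p: "sublinear p" and odd: "\<And>x. p (- x) \<le> - p x"
  shows "linear p"
proof -
  have neg: "p (- x) = - p x" for x
    using odd[of x] sublinear_minus_le[OF p, of x] by simp
  show ?thesis
  proof (rule linearI)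
    fix x y
    have "p (- x + - y) \<le> p (- x) + p (- y)"
      using p by (rule sublinear_add)
    then have "p x + p y \<le> p (x + y)"
      using neg[of "x + y"] by (simp add: neg)
    then show "p (x + y) = p x + p y"
      using sublinear_add[OF p, of x y] by simp
  next
    fix c :: real and x
    show "p (c *\<^sub>R x) = c *\<^sub>R p x"
    proof (cases "c \<ge> 0")
      case True then show ?thesis by (simp add: sublinear_scale_nonneg[OF p])
    next
      case False
      then have "p ((- c) *\<^sub>R x) = - c * p x"
        by (intro sublinear_scale[OF p]) simp
      then show ?thesis using neg[of "c *\<^sub>R x"] by simp
    qed
  qed
qed

text \<open>
  Applied to a singleton \<open>M\<close> with \<open>r = N m\<close> this shows that minimal sublinear functionals are
  odd; applied to the norm it yields separation of a convex set from a ball.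
\<close>

lemma sublinear_lowering:
  fixes N :: "'a::real_vector \<Rightarrow> real"
  assumes N: "sublinear N" and M: "convex M" "M \<noteq> {}" and r: "\<And>m. m \<in> M \<Longrightarrow> r \<le> N m"
  obtains p where "sublinear p" "\<And>x. p x \<le> N x" "\<And>m. m \<in> M \<Longrightarrow> p (- m) \<le> - r"
proof -
  \<comment> \<open>Any sublinear \<open>q\<close> below \<open>N\<close> with
    \<open>q (- m) \<le> - r\<close> on \<open>M\<close> satisfies \<open>q x \<le> q (x + t
    *\<^sub>R m) + t * q (- m) \<le> N (x + t *\<^sub>R m) - t * r\<close>. The infimum of these
    bounds is therefore the largest candidate.\<close>
  define T where "T x = {N (x + t *\<^sub>R m) - t * r | t m. t \<ge> 0 \<and> m \<in> M}" for x
  define p where "p x = Inf (T x)" for x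
  \<comment> \<open>Here \<open>r \<le> N m\<close> enters: it keeps the infimum finite.\<close>
  have T_lower: "- N (- x) \<le> v" if "v \<in> T x" for v x
  proof -
    obtain t m where v: "v = N (x + t *\<^sub>R m) - t * r" "t \<ge> 0" "m \<in> M"
      using \<open>v \<in> T x\<close> unfolding T_def by blast
    have "N (t *\<^sub>R m) \<le> N (x + t *\<^sub>R m) + N (- x)"
      using sublinear_add[OF N, of "x + t *\<^sub>R m" "- x"] by simp
    moreover have "t * r \<le> N (t *\<^sub>R m)"
      using v r by (simp add: sublinear_scale_nonneg[OF N] mult_left_mono)
    ultimately show ?thesis using v by simp
  qed
  have bdd: "bdd_below (T x)" for x
    using T_lower by (meson bdd_below.I)
  have T_ne: "T x \<noteq> {}" for x
    using M(2) unfolding T_def by blast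
  have p_le: "p x \<le> N (x + t *\<^sub>R m) - t * r" if "t \<ge> 0" "m \<in> M" for x t m
    unfolding p_def by (rule cInf_lower[OF _ bdd]) (use that in \<open>auto simp: T_def\<close>)
  have p_ge: "b \<le> p x" if "\<And>t m. t \<ge> 0 \<Longrightarrow> m \<in> M \<Longrightarrow> b \<le> N (x + t *\<^sub>R m) - t * r" for b x
    unfolding p_def by (rule cInf_greatest[OF T_ne]) (use that in \<open>auto simp: T_def\<close>)
  have join: "p (x + y) \<le> (N (x + t *\<^sub>R m) - t * r) + (N (y + u *\<^sub>R k) - u * r)"
    if tm: "t \<ge> 0" "m \<in> M" and uk: "u \<ge> 0" "k \<in> M" for x y t m u k
  proof -
    \<comment> \<open>Convexity merges the two multiples into one multiple of a single point of
      \<open>M\<close>; if both coefficients vanish, any point serves.\<close>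
    obtain l where l: "l \<in> M" "(t + u) *\<^sub>R l = t *\<^sub>R m + u *\<^sub>R k"
    proof (cases "t + u = 0")
      case True
      then have "t = 0" "u = 0" using tm uk by linarith+
      then show ?thesis using that[OF \<open>m \<in> M\<close>] by simp
    next
      case False
      then have "t + u > 0" using \<open>t \<ge> 0\<close> \<open>u \<ge> 0\<close> by linarith
      let ?l = "(t / (t + u)) *\<^sub>R m + (u / (t + u)) *\<^sub>R k"
      have "?l \<in> M"
        using M(1) \<open>t \<ge> 0\<close> \<open>u \<ge> 0\<close> \<open>m \<in> M\<close> \<open>k \<in> M\<close> \<open>t + u > 0\<close>
        by (intro convexD) (auto simp: add_divide_distrib[symmetric])
      moreover have "(t + u) *\<^sub>R ?l = t *\<^sub>R m + u *\<^sub>R k"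
        using False by (simp add: scaleR_add_right)
      ultimately show ?thesis using that by blast
    qed
    have "p (x + y) \<le> N (x + y + (t + u) *\<^sub>R l) - (t + u) * r"
      using tm uk l by (intro p_le) auto
    also have "x + y + (t + u) *\<^sub>R l = (x + t *\<^sub>R m) + (y + u *\<^sub>R k)"
      unfolding l(2) by simp
    also have "N \<dots> \<le> N (x + t *\<^sub>R m) + N (y + u *\<^sub>R k)"
      by (rule sublinear_add[OF N])
    finally show ?thesis by (simp add: algebra_simps)
  qed
  have "sublinear p"
  proof (rule sublinearI)
    fix x y
    \<comment> \<open>The infimum is taken in one argument at a time, first over
      \<open>(t, m)\<close> and then over \<open>(u, k)\<close>.\<close>
    have "p (x + y) - (N (y + u *\<^sub>R k) - u * r) \<le> p x" if "u \<ge> 0" "k \<in> M" for u k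
    proof (rule p_ge)
      fix t m assume "t \<ge> (0::real)" "m \<in> M"
      from join[OF this that, of x y]
      show "p (x + y) - (N (y + u *\<^sub>R k) - u * r) \<le> N (x + t *\<^sub>R m) - t * r" by simp
    qed
    then have "p (x + y) - p x \<le> p y"
      by (intro p_ge) (simp add: algebra_simps)
    then show "p (x + y) \<le> p x + p y" by simp
  next
    fix c :: real and x assume c: "c > 0"
    have "p (c *\<^sub>R x) / c \<le> p x"
    proof (rule p_ge)
      fix t m assume tm: "t \<ge> (0::real)" "m \<in> M"
      have "p (c *\<^sub>R x) \<le> N (c *\<^sub>R x + (c * t) *\<^sub>R m) - (c * t) * r"
        using tm c by (intro p_le) auto
      also have "c *\<^sub>R x + (c * t) *\<^sub>R m = c *\<^sub>R (x + t *\<^sub>R m)"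
        by (simp add: scaleR_add_right)
      also have "N \<dots> = c * N (x + t *\<^sub>R m)"
        using c by (rule sublinear_scale[OF N])
      finally show "p (c *\<^sub>R x) / c \<le> N (x + t *\<^sub>R m) - t * r"
        using c by (simp add: field_simps)
    qed
    then show "p (c *\<^sub>R x) \<le> c * p x" using c by (simp add: field_simps)
  qed
  moreover have "p x \<le> N x" for x
    using M(2) p_le[of 0 _ x] by auto
  moreover have "p (- m) \<le> - r" if "m \<in> M" for m
    using p_le[of 1 m "- m"] that sublinear_zero[OF N] by simp
  ultimately show ?thesis using that by blast
qed

text \<open>Zorn's lemma for the reversed pointwise order yields a minimal sublinear functional
  below \<open>p\<close>. Lowering it at a singleton cannot change it, so it is odd, hence
  linear.\<close>

theorem sublinear_linear_minorant:
  fixes p :: "'a::real_vector \<Rightarrow> real"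
  assumes p: "sublinear p"
  obtains f where "linear f" "\<And>x. f x \<le> p x"
proof -
  define Q where "Q = {q. sublinear q \<and> (\<forall>x. q x \<le> p x)}"
  have "\<exists>q\<in>Q. \<forall>g\<in>Q. g \<le> q \<longrightarrow> g = q"
  proof (rule predicate_Zorn)
    show "partial_order_on Q (relation_of (\<lambda>q g. g \<le> q) Q)"
      by (auto simp: partial_order_on_def preorder_on_def refl_on_def trans_def antisym_def
          relation_of_def)
  next
    fix H assume "H \<in> Chains (relation_of (\<lambda>q g. g \<le> q) Q)"
    then have HQ: "H \<subseteq> Q" and chain: "\<And>g h. g \<in> H \<Longrightarrow> h \<in> H \<Longrightarrow> g \<le> h \<or> h \<le> g"
      by (auto simp: Chains_def relation_of_def)
    show "\<exists>u\<in>Q. \<forall>q\<in>H. u \<le> q"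
    proof (cases "H = {}")
      case True then show ?thesis using p by (auto simp: Q_def)
    next
      case False
      have subl: "sublinear q" and le_p: "q x \<le> p x" if "q \<in> H" for q x
        using HQ that by (auto simp: Q_def)
      define u where "u x = (INF q\<in>H. q x)" for x
      \<comment> \<open>This bound does not depend on \<open>q\<close>, so the pointwise infimum of
        the chain exists.\<close>
      have "- p (- x) \<le> q x" if "q \<in> H" for q x
        using sublinear_minus_le[OF subl[OF that], of x] le_p[OF that, of "- x"] by linarith
      then have bdd: "bdd_below ((\<lambda>q. q x) ` H)" for x
        by (meson bdd_below.I2)
      have u_le: "u x \<le> q x" if "q \<in> H" for q x
        unfolding u_def using bdd that by (rule cINF_lower)
      have u_ge: "b \<le> u x" if "\<And>q. q \<in> H \<Longrightarrow> b \<le> q x" for b x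
        unfolding u_def using False that by (rule cINF_greatest)
      have "sublinear u"
      proof (rule sublinearI)
        fix x y
        \<comment> \<open>The smaller of two comparable functionals lies below both, and its own
          subadditivity gives the estimate.\<close>
        have *: "u (x + y) \<le> g x + h y" if gh: "g \<in> H" "h \<in> H" for g h
        proof -
          obtain k where k: "k \<in> H" "k \<le> g" "k \<le> h"
            using chain[OF gh] gh by auto
          have "u (x + y) \<le> k (x + y)" using k by (intro u_le)
          also have "\<dots> \<le> k x + k y" using subl[OF k(1)] by (rule sublinear_add)
          also have "\<dots> \<le> g x + h y" using k by (intro add_mono) (auto simp: le_fun_def)
          finally show ?thesis .
        qed
        have "u (x + y) - h y \<le> u x" if "h \<in> H" for h
          using * that by (intro u_ge) (simp add: algebra_simps)
        then have "u (x + y) - u x \<le> u y"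
          by (intro u_ge) (simp add: algebra_simps)
        then show "u (x + y) \<le> u x + u y" by simp
      next
        fix c :: real and x assume c: "c > 0"
        have "u (c *\<^sub>R x) / c \<le> u x"
        proof (rule u_ge)
          fix q assume q: "q \<in> H"
          show "u (c *\<^sub>R x) / c \<le> q x"
            using u_le[OF q, of "c *\<^sub>R x"] sublinear_scale[OF subl[OF q] c, of x] c
            by (simp add: field_simps)
        qed
        then show "u (c *\<^sub>R x) \<le> c * u x" using c by (simp add: field_simps)
      qed
      moreover have "u x \<le> p x" for x
        using False u_le le_p by (meson all_not_in_conv order_trans)
      ultimately have "u \<in> Q" by (simp add: Q_def)
      then show ?thesis using u_le by (auto simp: le_fun_def)
    qed
  qed
  then obtain q where q: "sublinear q" "\<And>x. q x \<le> p x"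
    and minimal: "\<And>g. g \<in> Q \<Longrightarrow> g \<le> q \<Longrightarrow> g = q"
    unfolding Q_def by blast
  have "q (- y) \<le> - q y" for y
  proof -
    obtain g where g: "sublinear g" "\<And>x. g x \<le> q x" "g (- y) \<le> - q y"
      using sublinear_lowering[OF q(1), of "{y}" "q y"] by auto
    have "g \<in> Q" using g(1,2) q(2) by (auto simp: Q_def intro: order_trans)
    then have "g = q" using g(2) by (intro minimal) (auto simp: le_fun_def)
    then show ?thesis using g(3) by simp
  qed
  then show ?thesis using that sublinear_odd_imp_linear q by blast
qed

text \<open>\<open>M\<close> stays at a positive distance \<open>r\<close> from 0, so the norm can
  be lowered to at most \<open>- r\<close> on \<open>- M\<close>. A linear minorant is then bounded
  by the norm and at least \<open>r\<close> on \<open>M\<close>.\<close>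

theorem separating_functional_zero:
  fixes M :: "'a::real_normed_vector set"
  assumes "convex M" "M \<noteq> {}" "0 \<notin> closure M"
  obtains f :: "'a \<Rightarrow>\<^sub>L real" and r where "norm f = 1" "r > 0" "\<And>m. m \<in> M \<Longrightarrow> r \<le> f m"
proof -
  obtain r where r: "r > 0" "\<And>m. m \<in> M \<Longrightarrow> r \<le> norm m"
    using assms(3) by (metis closure_approachable dist_0_norm dist_commute not_le)
  have norm: "sublinear (norm :: 'a \<Rightarrow> real)"
    by (rule sublinearI) (auto simp: norm_triangle_ineq)
  obtain p :: "'a \<Rightarrow> real" where p: "sublinear p" "\<And>x. p x \<le> norm x"
    "\<And>m. m \<in> M \<Longrightarrow> p (- m) \<le> - r"
    using sublinear_lowering[OF norm assms(1,2) r(2)] by blast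
  obtain g where g: "linear g" "\<And>x. g x \<le> p x"
    using sublinear_linear_minorant[OF p(1)] by blast
  have "\<bar>g x\<bar> \<le> norm x" for x
    using g(2)[of x] g(2)[of "- x"] p(2)[of x] p(2)[of "- x"] linear_neg[OF g(1), of x] by simp
  then have blin: "bounded_linear g"
    using g(1) by (intro bounded_linear.intro) (auto simp: bounded_linear_axioms_def intro!: exI[of _ 1])
  define h where "h = Blinfun g"
  have h: "blinfun_apply h = g"
    unfolding h_def using blin by (rule bounded_linear_Blinfun_apply)
  have h_M: "r \<le> h m" if "m \<in> M" for m
    using g(2)[of "- m"] p(3)[OF that] linear_neg[OF g(1), of m] by (simp add: h)
  \<comment> \<open>Positivity on the nonempty \<open>M\<close> excludes \<open>h = 0\<close>, so
    \<open>h\<close> can be normalized; the gap becomes \<open>r / norm h\<close>.\<close>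
  have "norm h > 0"
    using h_M assms(2) r(1) by fastforce
  moreover from this have "norm (h /\<^sub>R norm h) = 1" by simp
  ultimately show ?thesis
    using h_M r(1) that[of "h /\<^sub>R norm h" "r / norm h"]
    by (simp add: blinfun.scaleR_left divide_inverse mult.commute)
qed

section \<open>Cones and co-radiant sets\<close>

text \<open>Dilation by a positive factor maps \<open>K\<close> and its complement into themselves,
  hence also their closures, whose intersection is the frontier.\<close>

lemma frontier_cone_scale:
  fixes K :: "'a::real_normed_vector set"
  assumes "cone K" "x \<in> frontier K" "c > 0"
  shows "c *\<^sub>R x \<in> frontier K"
proof -
  have closure: "c *\<^sub>R x \<in> closure L" if "x \<in> closure L" "\<And>y. y \<in> L \<Longrightarrow> c *\<^sub>R y \<in> L" for L
  proof -
    have "c *\<^sub>R x \<in> closure ((*\<^sub>R) c ` L)"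
      using that(1) closure_scaleR[of c L] by blast
    also have "\<dots> \<subseteq> closure L" using that(2) by (intro closure_mono) auto
    finally show ?thesis .
  qed
  have "c *\<^sub>R y \<in> - K" if "y \<in> - K" for y
  proof
    assume "c *\<^sub>R y \<in> K"
    then have "(1 / c) *\<^sub>R (c *\<^sub>R y) \<in> K"
      using assms(1,3) by (intro mem_cone[of K "c *\<^sub>R y"]) auto
    then show False using that assms(3) by simp
  qed
  moreover have "c *\<^sub>R y \<in> K" if "y \<in> K" for y
    using that assms(1,3) by (intro mem_cone) auto
  ultimately show ?thesis
    using assms(2) closure by (auto simp: frontier_closures)
qed

section \<open>Bishop-Phelps cones\<close>

lemma convex_Bishop_Phelps_cone:
  fixes f :: "'a::real_normed_vector \<Rightarrow>\<^sub>L real"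
  assumes "\<alpha> \<ge> 0"
  shows "convex {z. \<alpha> * norm z < f z}"
proof (rule convexI)
  fix x y and u v :: real
  assume x: "x \<in> {z. \<alpha> * norm z < f z}" and y: "y \<in> {z. \<alpha> * norm z < f z}"
    and uv: "0 \<le> u" "0 \<le> v" "u + v = 1"
  have "\<alpha> * norm (u *\<^sub>R x + v *\<^sub>R y) \<le> \<alpha> * (u * norm x + v * norm y)"
    using assms uv norm_triangle_ineq[of "u *\<^sub>R x" "v *\<^sub>R y"] by (intro mult_left_mono) auto
  also have "\<dots> = u * (\<alpha> * norm x) + v * (\<alpha> * norm y)"
    by (simp add: algebra_simps)
  \<comment> \<open>Some weight is positive: strictness comes from \<open>y\<close> when
    \<open>u = 0\<close> and from \<open>x\<close> otherwise.\<close>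
  also have "\<dots> < u * f x + v * f y"
  proof (cases "u = 0")
    case True then show ?thesis using y uv by simp
  next
    case False
    then have "u * (\<alpha> * norm x) < u * f x" using x uv by simp
    moreover have "v * (\<alpha> * norm y) \<le> v * f y" using y uv by (intro mult_left_mono) auto
    ultimately show ?thesis by simp
  qed
  finally show "u *\<^sub>R x + v *\<^sub>R y \<in> {z. \<alpha> * norm z < f z}"
    by (simp add: blinfun.add_right blinfun.scaleR_right)
qed

text \<open>A connected set meeting both \<open>K\<close> and its complement meets the frontier;
  normalizing such a point contradicts the bound on \<open>f\<close> there.\<close>

lemma Bishop_Phelps_cone_subset:
  fixes f :: "'a::real_normed_vector \<Rightarrow>\<^sub>L real"
  assumes "cone K" "\<alpha> \<ge> 0"
    and frontier: "\<And>y. y \<in> frontier K \<Longrightarrow> norm y = 1 \<Longrightarrow> f y \<le> \<alpha>"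
    and w: "w \<in> K" "\<alpha> * norm w < f w"
  shows "{z. \<alpha> * norm z < f z} \<subseteq> K"
proof (rule ccontr)
  let ?D = "{z. \<alpha> * norm z < f z}"
  assume "\<not> ?D \<subseteq> K"
  then have "?D \<inter> frontier K \<noteq> {}"
    using w convex_connected[OF convex_Bishop_Phelps_cone[OF assms(2), of f]]
    by (intro connected_Int_frontier) auto
  then obtain y where y: "y \<in> frontier K" "\<alpha> * norm y < f y" by blast
  then have "norm y > 0" by auto
  then have "f ((1 / norm y) *\<^sub>R y) \<le> \<alpha>"
    using frontier_cone_scale[OF assms(1) y(1)] by (intro frontier) auto
  then show False
    using y(2) \<open>norm y > 0\<close> by (simp add: blinfun.scaleR_right field_simps)
qed

section \<open>Co-radiant neighborhoods and the functionals \<open>pfun\<close>\<close>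

lemma norm_ge_corad_dist: "c \<in> C \<Longrightarrow> corad_dist C \<le> norm c"
  unfolding corad_dist_def by (rule cINF_lower) (auto intro: bdd_belowI[of _ 0])

lemma subset_corad_nbhd:
  assumes "\<delta> \<ge> 0"
  shows "C \<subseteq> corad_nbhd C \<delta>"
proof
  fix c assume "c \<in> C"
  moreover have "0 \<in> scaled \<delta> (cball 0 1 :: 'a set)"
    unfolding scaled_def by (rule image_eqI[of _ _ 0]) auto
  ultimately have "c + 0 \<in> {c + b | c b. c \<in> C \<and> b \<in> scaled \<delta> (cball 0 1)}" by blast
  then show "c \<in> corad_nbhd C \<delta>"
    unfolding corad_nbhd_def corad_def
    by (intro CollectI exI[of _ 1] exI[of _ c]) simp
qed

lemma corad_nbhd_scale:
  assumes "x \<in> corad_nbhd C \<delta>" "t \<ge> 1"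
  shows "t *\<^sub>R x \<in> corad_nbhd C \<delta>"
proof -
  obtain c s where cs: "x = c *\<^sub>R s" "c \<ge> 1"
    "s \<in> {c + b | c b. c \<in> C \<and> b \<in> scaled \<delta> (cball 0 1)}"
    using assms(1) unfolding corad_nbhd_def corad_def by blast
  have "1 * 1 \<le> t * c"
    using cs assms(2) by (intro mult_mono) auto
  then show ?thesis
    using cs unfolding corad_nbhd_def corad_def by (auto intro!: exI[of _ "t * c"])
qed

lemma mem_scaled_sphere: "x \<in> scaled t (sphere 0 1) \<Longrightarrow> norm x = \<bar>t\<bar>"
  by (auto simp: scaled_def)

lemma pfun_add_le:
  assumes "\<alpha> \<ge> 0"
  shows "pfun f \<alpha> (x + y) \<le> pfun f \<alpha> x + pfun f \<alpha> y"
  using mult_left_mono[OF norm_triangle_ineq[of x y] assms]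
  by (simp add: pfun_def blinfun.add_right algebra_simps)

text \<open>A functional positive on the difference of the hulls separates the two sets with gap
  \<open>r\<close>. The adjoined point 0 forces \<open>s \<ge> 0\<close>, so every level above
  \<open>s\<close> is positive.\<close>

lemma SSP_separation:
  assumes "SSP C K" "C \<inter> sphere 0 1 \<noteq> {}"
  obtains f :: "'a::real_normed_vector \<Rightarrow>\<^sub>L real" and s r where
    "norm f = 1" "s \<ge> 0" "r > 0"
    "\<And>y. y \<in> frontier K \<Longrightarrow> norm y = 1 \<Longrightarrow> f y \<le> s"
    "\<And>x. x \<in> C \<Longrightarrow> norm x = 1 \<Longrightarrow> s + r \<le> f x"
proof -
  let ?P = "C \<inter> sphere 0 1" and ?Q = "(frontier K \<inter> sphere 0 1) \<union> {0}"
  let ?M = "{x - y | x y. x \<in> convex hull ?P \<and> y \<in> convex hull ?Q}"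
  have M_eq: "?M = (\<Union>x\<in>convex hull ?P. \<Union>y\<in>convex hull ?Q. {x - y})"
    by blast
  have "convex ?M"
    unfolding M_eq by (intro convex_differences convex_convex_hull)
  moreover obtain x0 where x0: "x0 \<in> ?P" using assms(2) by blast
  have mem: "x - y \<in> ?M" if "x \<in> ?P" "y \<in> ?Q" for x y
    using that hull_inc[of x ?P convex] hull_inc[of y ?Q convex] by blast
  moreover have "?M \<noteq> {}" using mem[OF x0, of 0] by blast
  moreover have "0 \<notin> closure ?M" using assms(1) by (simp add: SSP_def)
  ultimately obtain f :: "'a \<Rightarrow>\<^sub>L real" and r where f: "norm f = 1" "r > 0"
    "\<And>m. m \<in> ?M \<Longrightarrow> r \<le> f m"
    using separating_functional_zero by blast
  have sep: "f y + r \<le> f x" if "x \<in> ?P" "y \<in> ?Q" for x y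
    using f(3)[OF mem[OF that]] by (simp add: blinfun.diff_right)
  \<comment> \<open>The supremum is finite because the value of \<open>f\<close> at a single unit
    vector \<open>x0\<close> of \<open>C\<close> bounds it.\<close>
  define s where "s = Sup (f ` ?Q)"
  have "bdd_above (f ` ?Q)"
    using sep[OF x0] f(2) by (intro bdd_aboveI2[of _ _ "f x0"]) force
  then have s_upper: "f y \<le> s" if "y \<in> ?Q" for y
    unfolding s_def using that by (intro cSUP_upper)
  have s_least: "s + r \<le> f x" if "x \<in> ?P" for x
  proof -
    have "s \<le> f x - r"
      unfolding s_def using sep[OF that] by (intro cSUP_least) (auto simp: algebra_simps)
    then show ?thesis by simp
  qed
  show ?thesis
    using that[of f s r] f(1,2) s_upper[of 0] s_upper s_least by auto
qed

text \<open>The conjunct \<open>bdd_below V\<close> certifies that \<open>Inf V\<close> is a genuine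
  infimum, as \<open>Inf\<close> of a real set unbounded below carries no information.\<close>

theorem theorem5p11:
  fixes C A :: "'a::real_normed_vector set" and \<delta> :: real and n :: nat
  assumes "coradiant C" and "corad_dist C > 0"
    and "0 < \<delta>" and "\<delta> < corad_dist C"
    and "C \<inter> scaled (real n) (sphere 0 1) \<noteq> {}"
    and "SSP (cone hull C) (cone hull (corad_nbhd C \<delta> \<inter> scaled (real n) (sphere 0 1)))"
  shows "\<exists>\<alpha>1 \<alpha>2 (f :: 'a \<Rightarrow>\<^sub>L real) \<eta>.
    0 < \<alpha>1 \<and> \<alpha>1 < \<alpha>2 \<and> \<alpha>2 \<le> 1 \<and> norm f = 1 \<and> 0 < \<eta> \<and> \<eta> \<le> 1 \<and>
    (let V = {blinfun_apply f x' - \<alpha> * norm x' | x' \<alpha>. x' \<in> C \<and> \<alpha> \<in> {\<alpha>1<..<\<alpha>2}};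
         lam = Inf V
     in bdd_below V \<and> lam > 0 \<and>
        (\<forall>\<epsilon> \<alpha> x0. 0 < \<epsilon> \<and> \<epsilon> < 1 \<and> \<alpha> \<in> {\<alpha>1<..<\<alpha>2} \<and>
             x0 \<in> AE_points A (scaled \<eta> (corad_nbhd C \<delta>)) \<epsilon> \<longrightarrow>
           (\<forall>x\<in>A. pfun f \<alpha> (x - x0) > - lam * \<epsilon>) \<and>
           (\<lambda>x. x0 + x) ` {x. pfun f \<alpha> x < 0} \<inter> A \<subseteq> AE_points A C \<epsilon>))"
proof -
  let ?d = "corad_dist C"
  let ?N = "corad_nbhd C \<delta> \<inter> scaled (real n) (sphere 0 1)"
  let ?K = "cone hull ?N"
  have C_pos: "norm c > 0" if "c \<in> C" for c
    using norm_ge_corad_dist[OF that] assms(2) by linarith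
  have unit: "(1 / norm c) *\<^sub>R c \<in> cone hull C" if "c \<in> C" for c
    using that by (intro mem_cone[OF cone_cone_hull] hull_inc) auto
  obtain w where w: "w \<in> C" "w \<in> scaled (real n) (sphere 0 1)" using assms(5) by blast
  \<comment> \<open>Vectors of \<open>C\<close> have positive norm, which rules out
    \<open>n = 0\<close>.\<close>
  have "norm w = real n" using mem_scaled_sphere[OF w(2)] by simp
  then have n: "real n > 0" using C_pos[OF w(1)] by linarith
  have "(1 / norm w) *\<^sub>R w \<in> cone hull C \<inter> sphere 0 1"
    using unit[OF w(1)] C_pos[OF w(1)] by simp
  then obtain f :: "'a \<Rightarrow>\<^sub>L real" and s r where f: "norm f = 1" and s: "s \<ge> 0" and r: "r > 0"
    and f_frontier: "\<And>y. y \<in> frontier ?K \<Longrightarrow> norm y = 1 \<Longrightarrow> f y \<le> s"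
    and f_unit: "\<And>x. x \<in> cone hull C \<Longrightarrow> norm x = 1 \<Longrightarrow> s + r \<le> f x"
    using SSP_separation[OF assms(6)] by blast
  have f_le: "f x \<le> norm x" for x
    using norm_blinfun[of f x] f by simp
  have f_C: "(s + r) * norm c \<le> f c" if "c \<in> C" for c
    using f_unit[OF unit[OF that]] C_pos[OF that] by (simp add: blinfun.scaleR_right field_simps)
  \<comment> \<open>Since \<open>norm f = 1\<close>, evaluation at \<open>w\<close> caps
    \<open>s + r\<close>; this yields \<open>\<alpha>2 \<le> 1\<close>.\<close>
  have sr: "s + r \<le> 1"
  proof -
    have "(s + r) * norm w \<le> 1 * norm w" using f_C[OF w(1)] f_le[of w] by simp
    then show ?thesis using C_pos[OF w(1)] by (simp only: mult_le_cancel_right_pos)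
  qed
  \<comment> \<open>The middle third of the gap: lying above \<open>s\<close> keeps the frontier of
    \<open>?K\<close> outside the open cones, and the \<open>r / 3\<close> left below
    \<open>s + r\<close> gives the lower bound \<open>r / 3 * ?d\<close> for
    \<open>V\<close>.\<close>
  define \<alpha>1 where "\<alpha>1 = s + r / 3"
  define \<alpha>2 where "\<alpha>2 = s + 2 * r / 3"
  define V where "V = {f x' - \<alpha> * norm x' | x' \<alpha>. x' \<in> C \<and> \<alpha> \<in> {\<alpha>1<..<\<alpha>2}}"
  define lam where "lam = Inf V"
  \<comment> \<open>The term \<open>lam / n\<close> ensures \<open>\<eta> * n \<le> lam\<close>,
    which makes the dilation factor in \<open>nbhd\<close> at least 1.\<close>
  define \<eta> where "\<eta> = min 1 (lam / n)"
  have \<alpha>: "0 < \<alpha>1" "\<alpha>1 < \<alpha>2" "\<alpha>2 \<le> 1"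
    using s r sr by (auto simp: \<alpha>1_def \<alpha>2_def)
  have V_lower: "r / 3 * ?d \<le> v" if v: "v \<in> V" for v
  proof -
    obtain c \<alpha> where c: "v = f c - \<alpha> * norm c" "c \<in> C" "\<alpha> < \<alpha>2"
      using v unfolding V_def by auto
    have "r / 3 * ?d \<le> (s + r - \<alpha>) * norm c"
      using c(3) s r norm_ge_corad_dist[OF c(2)] assms(2)
      by (intro mult_mono) (auto simp: \<alpha>2_def)
    also have "\<dots> \<le> v" using c(1) f_C[OF c(2)] by (simp add: algebra_simps)
    finally show ?thesis .
  qed
  then have V_bdd: "bdd_below V" by (meson bdd_below.I)
  have "(\<alpha>1 + \<alpha>2) / 2 \<in> {\<alpha>1<..<\<alpha>2}" using \<alpha> by simp
  then have "V \<noteq> {}" using w(1) unfolding V_def by blast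
  then have "r / 3 * ?d \<le> lam"
    unfolding lam_def using V_lower by (rule cInf_greatest)
  moreover have "r / 3 * ?d > 0" using r assms(2) by simp
  ultimately have lam: "lam > 0" by linarith
  have lam_le: "lam \<le> f c - \<alpha> * norm c" if "c \<in> C" "\<alpha> \<in> {\<alpha>1<..<\<alpha>2}" for c \<alpha>
    unfolding lam_def by (rule cInf_lower[OF _ V_bdd]) (use that in \<open>auto simp: V_def\<close>)
  have \<eta>: "0 < \<eta>" "\<eta> \<le> 1" "\<eta> * n \<le> lam"
    using lam n by (auto simp: \<eta>_def min_def field_simps)
  have w_K: "w \<in> ?K"
    using w subset_corad_nbhd[of \<delta> C] assms(3) by (intro hull_inc) auto
  have cone_subset: "z \<in> ?K" if "\<alpha> * norm z < f z" "\<alpha> \<in> {\<alpha>1<..<\<alpha>2}" for z \<alpha>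
  proof -
    have "{z. \<alpha> * norm z < f z} \<subseteq> ?K"
    proof (rule Bishop_Phelps_cone_subset[OF cone_cone_hull _ _ w_K])
      show "\<alpha> \<ge> 0" using that \<alpha> by simp
      show "f y \<le> \<alpha>" if "y \<in> frontier ?K" "norm y = 1" for y
        using f_frontier[OF that] \<open>\<alpha> \<in> _\<close> r by (simp add: \<alpha>1_def)
      show "\<alpha> * norm w < f w" using lam_le[OF w(1) that(2)] lam by simp
    qed
    then show ?thesis using that by blast
  qed
  have nbhd: "z \<in> scaled \<epsilon> (scaled \<eta> (corad_nbhd C \<delta>))"
    if z: "lam * \<epsilon> \<le> f z - \<alpha> * norm z" and \<epsilon>: "\<epsilon> > 0" and \<alpha>': "\<alpha> \<in> {\<alpha>1<..<\<alpha>2}" for z \<epsilon> \<alpha>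
  proof -
    have pos: "0 < lam * \<epsilon>" using lam \<epsilon> by simp
    have "z \<in> ?K" using z \<alpha>' pos by (intro cone_subset) auto
    \<comment> \<open>As \<open>norm k = n\<close>, the bound
      \<open>lam * \<epsilon> \<le> norm z\<close> becomes
      \<open>\<epsilon> * \<eta> \<le> t\<close>. Dilating \<open>k\<close> by
      \<open>t / (\<epsilon> * \<eta>)\<close> thus stays in the co-radiant neighborhood.\<close>
    then obtain t k where k: "z = t *\<^sub>R k" "t \<ge> 0" "k \<in> corad_nbhd C \<delta>"
      "k \<in> scaled (real n) (sphere 0 1)"
      unfolding cone_hull_expl by blast
    have "norm z = t * n"
      using k mem_scaled_sphere[OF k(4)] by simp
    moreover have "0 \<le> \<alpha> * norm z" using \<alpha> \<alpha>' by simp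
    then have "lam * \<epsilon> \<le> norm z" using z f_le[of z] by linarith
    moreover have "\<epsilon> * (\<eta> * n) \<le> \<epsilon> * lam" using \<eta>(3) \<epsilon> by (intro mult_left_mono) auto
    ultimately have "(\<epsilon> * \<eta>) * n \<le> t * n" by (simp add: algebra_simps)
    then have "\<epsilon> * \<eta> \<le> t" using n by simp
    then have "t / (\<epsilon> * \<eta>) \<ge> 1" using \<epsilon> \<eta>(1) by simp
    then have "(t / (\<epsilon> * \<eta>)) *\<^sub>R k \<in> corad_nbhd C \<delta>" using k(3) by (rule corad_nbhd_scale[rotated])
    moreover have "z = \<epsilon> *\<^sub>R \<eta> *\<^sub>R (t / (\<epsilon> * \<eta>)) *\<^sub>R k"
      using k(1) \<epsilon> \<eta>(1) by simp
    ultimately show ?thesis unfolding scaled_def by blast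
  qed

  \<comment> \<open>The two conclusions about efficient points\<close>
  have efficient: "pfun f \<alpha> (x - x0) > - lam * \<epsilon>"
    if \<epsilon>: "0 < \<epsilon>" and \<alpha>': "\<alpha> \<in> {\<alpha>1<..<\<alpha>2}"
      and x0: "x0 \<in> AE_points A (scaled \<eta> (corad_nbhd C \<delta>)) \<epsilon>" and x: "x \<in> A" for \<epsilon> \<alpha> x0 x
  proof (rule ccontr)
    assume "\<not> ?thesis"
    then have le: "lam * \<epsilon> \<le> f (x0 - x) - \<alpha> * norm (x0 - x)"
      by (simp add: pfun_def blinfun.diff_right norm_minus_commute)
    then have "x0 - x \<in> scaled \<epsilon> (scaled \<eta> (corad_nbhd C \<delta>))" using \<epsilon> \<alpha>' by (rule nbhd)
    then obtain k where "k \<in> scaled \<eta> (corad_nbhd C \<delta>)" "x0 - x = \<epsilon> *\<^sub>R k"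
      unfolding scaled_def[of \<epsilon>] by blast
    then have "x - x0 \<in> scaled (- \<epsilon>) (scaled \<eta> (corad_nbhd C \<delta>))"
      unfolding scaled_def[of "- \<epsilon>"] by (intro image_eqI[of _ _ k]) (simp_all add: algebra_simps)
    \<comment> \<open>Efficiency leaves only \<open>x = x0\<close>, where \<open>le\<close> would
      read \<open>lam * \<epsilon> \<le> 0\<close>.\<close>
    then have "x - x0 = 0" using x0 x unfolding AE_points_def by blast
    then show False using le mult_pos_pos[OF lam \<epsilon>] by simp
  qed
  have inclusion: "x0 + y \<in> AE_points A C \<epsilon>"
    if \<epsilon>: "0 < \<epsilon>" and \<alpha>': "\<alpha> \<in> {\<alpha>1<..<\<alpha>2}"
      and x0: "x0 \<in> AE_points A (scaled \<eta> (corad_nbhd C \<delta>)) \<epsilon>"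
      and y: "pfun f \<alpha> y < 0" "x0 + y \<in> A" for \<epsilon> \<alpha> x0 y
  proof -
    \<comment> \<open>Subadditivity would give
      \<open>pfun f \<alpha> (x - x0) < - \<epsilon> * lam\<close>, against
      \<open>efficient\<close>. So the intersection in \<open>AE_points\<close> is even
      empty.\<close>
    have False if x: "x \<in> A" and c: "c \<in> C" "x - (x0 + y) = - \<epsilon> *\<^sub>R c" for x c
    proof -
      have "x - x0 = y + - \<epsilon> *\<^sub>R c" using c(2) by (simp add: algebra_simps)
      then have "pfun f \<alpha> (x - x0) \<le> pfun f \<alpha> y + pfun f \<alpha> (- \<epsilon> *\<^sub>R c)"
        using \<alpha> \<alpha>' pfun_add_le[of \<alpha> f y "- \<epsilon> *\<^sub>R c"] by simp
      moreover have "pfun f \<alpha> (- \<epsilon> *\<^sub>R c) = - (\<epsilon> * (f c - \<alpha> * norm c))"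
        using \<epsilon> by (simp add: pfun_def blinfun.scaleR_right blinfun.minus_right algebra_simps)
      moreover have "\<epsilon> * lam \<le> \<epsilon> * (f c - \<alpha> * norm c)"
        using lam_le[OF c(1) \<alpha>'] \<epsilon> by (intro mult_left_mono) auto
      moreover have "- lam * \<epsilon> < pfun f \<alpha> (x - x0)" using \<epsilon> \<alpha>' x0 x by (rule efficient)
      ultimately show False using y(1) by (simp add: mult.commute)
    qed
    then show ?thesis using y(2) unfolding AE_points_def scaled_def by blast
  qed
  have "\<forall>\<epsilon> \<alpha> x0. 0 < \<epsilon> \<and> \<epsilon> < 1 \<and> \<alpha> \<in> {\<alpha>1<..<\<alpha>2} \<and>
             x0 \<in> AE_points A (scaled \<eta> (corad_nbhd C \<delta>)) \<epsilon> \<longrightarrow>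
           (\<forall>x\<in>A. pfun f \<alpha> (x - x0) > - lam * \<epsilon>) \<and>
           (\<lambda>x. x0 + x) ` {x. pfun f \<alpha> x < 0} \<inter> A \<subseteq> AE_points A C \<epsilon>"
    using efficient inclusion by blast
  then show ?thesis
    using \<alpha> f \<eta>(1,2) V_bdd lam unfolding Let_def V_def lam_def by blast
qed

end
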